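(* Let $\mathfrak{g}=A_{5,1}$ and let $\langle\cdot,\cdot\rangle$ be an inner product on $\mathfrak{g}$. Let $\eta>0$ and let $\{v_1,\dots,v_5\}$ be a basis of $\mathfrak{g}$, orthonormal with respect to $\eta\langle\cdot,\cdot\rangle$, whose only nonzero brackets (up to antisymmetry) are $[v_1,v_2]=\alpha v_4+\beta v_5$, $[v_1,v_3]=\gamma v_5$, with $\alpha,\gamma>0$ and $\beta\in\mathbb{R}$. Then $\langle\cdot,\cdot\rangle$ is an algebraic Schouten soliton if and only if $\beta=0$ and $\alpha=\gamma$.
   Context: $A_{5,1}$ is the five-dimensional real nilpotent Lie algebra having a basis with the brackets displayed in the claim. An inner product on $\mathfrak{g}$ is identified with the left-invariant Riemannian metric $g$ it induces on the simply connected Lie group $G$ with Lie algebra $\mathfrak{g}$. Let $ric_g$ be the Ricci curvature tensor of $(G,g)$ (Levi-Civita connection), viewed as a symmetric bilinear form on $\mathfrak{g}$; since $\mathfrak{g}$ is nilpotent, $ric_g(u,v)=-\frac12\mathrm{tr}(ad_u\circ ad_v^* )-\frac14\mathrm{tr}(J_u\circ J_v)$, where $ad_uv=[u,v]$, $ad_v^*$ is the $g$-transpose of $ad_v$, and $J_uv=ad_v^*u$. The Ricci operator $Ric_g$ is defined by $ric_g(u,v)=g(Ric_g(u),v)$ and $s=\mathrm{tr}(Ric_g)$ is the scalar curvature. The metric $g$ is an algebraic Schouten soliton if there are real numbers $\lambda_0,c$ such that $Ric_g-(s\lambda_0+c)\,\mathrm{Id}$ is a derivation of $\mathfrak{g}$.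 *)

theory Defs
  imports "HOL-Analysis.Analysis"
begin

section \<open>Lie algebras and inner products\<close>

locale real_lie_algebra =
  fixes br :: "'g::real_vector \<Rightarrow> 'g \<Rightarrow> 'g"
  assumes bilinear_br: "bilinear br"
    and alternating: "br x x = 0"
    and jacobi: "br x (br y z) + br y (br z x) + br z (br x y) = 0"

locale inner_product =
  fixes ip :: "'g::real_vector \<Rightarrow> 'g \<Rightarrow> real"
  assumes bilinear_ip: "bilinear ip"
    and sym: "ip x y = ip y x"
    and pos: "x \<noteq> 0 \<Longrightarrow> ip x x > 0"

definition derivation :: "('g::real_vector \<Rightarrow> 'g \<Rightarrow> 'g) \<Rightarrow> ('g \<Rightarrow> 'g) \<Rightarrow> bool" where
  "derivation br D \<longleftrightarrow> linear D \<and> (\<forall>x y. D (br x y) = br (D x) y + br x (D y))"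

text \<open>The trace of an endomorphism of a finite-dimensional space; by \<open>lin_trace_eq\<close> below the
  chosen basis is irrelevant.\<close>

definition lin_trace :: "('g::real_vector \<Rightarrow> 'g) \<Rightarrow> real" where
  "lin_trace f =
     (let B = (SOME B. independent B \<and> span B = UNIV) in \<Sum>b\<in>B. representation B (f b) b)"

definition orthonormal_wrt :: "('g::real_vector \<Rightarrow> 'g \<Rightarrow> real) \<Rightarrow> 'g set \<Rightarrow> bool" where
  "orthonormal_wrt ip B \<longleftrightarrow> finite B \<and> (\<forall>x\<in>B. \<forall>y\<in>B. ip x y = (if x = y then 1 else 0))"

section \<open>Curvature of a left-invariant metric\<close>

text \<open>All tensors are evaluated on left-invariant vector fields, that is, on the Lie algebra.  On
  these the inner product of two fields is constant, so metric compatibility of the connection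
  reads \<open>0 = \<langle>\<nabla>\<^sub>x y, z\<rangle> + \<langle>y, \<nabla>\<^sub>x z\<rangle>\<close>.\<close>

definition is_levi_civita ::
    "('g::real_vector \<Rightarrow> 'g \<Rightarrow> 'g) \<Rightarrow> ('g \<Rightarrow> 'g \<Rightarrow> real) \<Rightarrow> ('g \<Rightarrow> 'g \<Rightarrow> 'g) \<Rightarrow> bool" where
  "is_levi_civita br ip N \<longleftrightarrow> bilinear N
     \<and> (\<forall>x y. N x y - N y x = br x y)
     \<and> (\<forall>x y z. ip (N x y) z + ip y (N x z) = 0)"

definition levi_civita ::
    "('g::real_vector \<Rightarrow> 'g \<Rightarrow> 'g) \<Rightarrow> ('g \<Rightarrow> 'g \<Rightarrow> real) \<Rightarrow> 'g \<Rightarrow> 'g \<Rightarrow> 'g" where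
  "levi_civita br ip = (THE N. is_levi_civita br ip N)"

definition curvature ::
    "('g::real_vector \<Rightarrow> 'g \<Rightarrow> 'g) \<Rightarrow> ('g \<Rightarrow> 'g \<Rightarrow> real) \<Rightarrow> 'g \<Rightarrow> 'g \<Rightarrow> 'g \<Rightarrow> 'g" where
  "curvature br ip x y z =
     (let N = levi_civita br ip in N x (N y z) - N y (N x z) - N (br x y) z)"

definition ricci ::
    "('g::real_vector \<Rightarrow> 'g \<Rightarrow> 'g) \<Rightarrow> ('g \<Rightarrow> 'g \<Rightarrow> real) \<Rightarrow> 'g \<Rightarrow> 'g \<Rightarrow> real" where
  "ricci br ip u v = lin_trace (\<lambda>x. curvature br ip x u v)"

definition ricci_op ::
    "('g::real_vector \<Rightarrow> 'g \<Rightarrow> 'g) \<Rightarrow> ('g \<Rightarrow> 'g \<Rightarrow> real) \<Rightarrow> 'g \<Rightarrow> 'g" where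
  "ricci_op br ip u = (THE w. \<forall>v. ricci br ip u v = ip w v)"

definition scalar_curvature ::
    "('g::real_vector \<Rightarrow> 'g \<Rightarrow> 'g) \<Rightarrow> ('g \<Rightarrow> 'g \<Rightarrow> real) \<Rightarrow> real" where
  "scalar_curvature br ip = lin_trace (ricci_op br ip)"

definition algebraic_schouten_soliton ::
    "('g::real_vector \<Rightarrow> 'g \<Rightarrow> 'g) \<Rightarrow> ('g \<Rightarrow> 'g \<Rightarrow> real) \<Rightarrow> bool" where
  "algebraic_schouten_soliton br ip \<longleftrightarrow>
     (\<exists>l0 c :: real. derivation br
        (\<lambda>u. ricci_op br ip u - (scalar_curvature br ip * l0 + c) *\<^sub>R u))"

section \<open>The Lie algebra $A_{5,1}$\<close>

text \<open>\<open>v 1, \<dots>, v 5\<close> is a basis; antisymmetry determines the brackets not listed.\<close>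

definition A51_frame ::
    "('g::real_vector \<Rightarrow> 'g \<Rightarrow> 'g) \<Rightarrow> (nat \<Rightarrow> 'g) \<Rightarrow> real \<Rightarrow> real \<Rightarrow> real \<Rightarrow> bool" where
  "A51_frame br v \<alpha> \<beta> \<gamma> \<longleftrightarrow>
     inj_on v {1..5} \<and> independent (v ` {1..5}) \<and> span (v ` {1..5}) = UNIV
     \<and> br (v 1) (v 2) = \<alpha> *\<^sub>R v 4 + \<beta> *\<^sub>R v 5
     \<and> br (v 1) (v 3) = \<gamma> *\<^sub>R v 5
     \<and> (\<forall>i j. 1 \<le> i \<and> i < j \<and> j \<le> 5 \<and> (i, j) \<noteq> (1, 2) \<and> (i, j) \<noteq> (1, 3)
            \<longrightarrow> br (v i) (v j) = 0)"

text \<open>The isomorphism type of $A_{5,1}$; by \<open>is_A51_iff\<close> below, the structure constants may be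
  replaced by any \<open>\<alpha>, \<beta>, \<gamma>\<close> with \<open>\<alpha>, \<gamma> > 0\<close>.\<close>

definition is_A51 :: "('g::real_vector \<Rightarrow> 'g \<Rightarrow> 'g) \<Rightarrow> bool" where
  "is_A51 br \<longleftrightarrow> real_lie_algebra br \<and> (\<exists>e. A51_frame br e 1 0 1)"

section \<open>Well-definedness\<close>

lemma lin_trace_indep:
  fixes f :: "'g::real_vector \<Rightarrow> 'g"
  assumes f: "linear f"
    and B: "finite B" "independent B" "span B = UNIV"
    and C: "finite C" "independent C" "span C = UNIV"
  shows "(\<Sum>b\<in>B. representation B (f b) b) = (\<Sum>c\<in>C. representation C (f c) c)"
proof -
  interpret f: linear f by fact
  have eB: "x = (\<Sum>b\<in>B. representation B x b *\<^sub>R b)" for x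
    using real_vector.sum_representation_eq[OF B(2) _ B(1) order_refl, of x] B(3) by simp
  have eC: "x = (\<Sum>c\<in>C. representation C x c *\<^sub>R c)" for x
    using real_vector.sum_representation_eq[OF C(2) _ C(1) order_refl, of x] C(3) by simp
  have rB: "representation B (\<Sum>i\<in>I. a i *\<^sub>R h i) b = (\<Sum>i\<in>I. a i * representation B (h i) b)"
    for I :: "'g set" and a h b
    using B by (simp add: real_vector.representation_sum real_vector.representation_scale)
  have rC: "representation C (\<Sum>i\<in>I. a i *\<^sub>R h i) b = (\<Sum>i\<in>I. a i * representation C (h i) b)"
    for I :: "'g set" and a h b
    using C by (simp add: real_vector.representation_sum real_vector.representation_scale)
  have "(\<Sum>b\<in>B. representation B (f b) b)
      = (\<Sum>b\<in>B. \<Sum>c\<in>C. representation C b c * representation B (f c) b)"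
  proof (rule sum.cong[OF refl])
    fix b
    have "f b = (\<Sum>c\<in>C. representation C b c *\<^sub>R f c)"
      by (subst eC[of b]) (simp add: f.sum f.scale)
    then show "representation B (f b) b = (\<Sum>c\<in>C. representation C b c * representation B (f c) b)"
      by (simp add: rB)
  qed
  also have "\<dots> = (\<Sum>c\<in>C. \<Sum>b\<in>B. representation B (f c) b * representation C b c)"
    by (subst sum.swap) (simp add: mult.commute)
  also have "\<dots> = (\<Sum>c\<in>C. representation C (f c) c)"
    by (rule sum.cong[OF refl]) (simp add: rC[symmetric] eB[symmetric])
  finally show ?thesis .
qed

lemma lin_trace_eq:
  fixes f :: "'g::real_vector \<Rightarrow> 'g"
  assumes "linear f" "finite B" "independent B" "span B = UNIV"
  shows "lin_trace f = (\<Sum>b\<in>B. representation B (f b) b)"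
proof -
  define C :: "'g set" where "C = (SOME B. independent B \<and> span B = UNIV)"
  have "independent C \<and> span C = UNIV"
    unfolding C_def by (rule someI[of _ B]) (use assms in blast)
  moreover from this have "finite C"
    using real_vector.independent_span_bound[of B C] assms by auto
  ultimately show ?thesis
    unfolding lin_trace_def Let_def C_def[symmetric] using assms by (intro lin_trace_indep) auto
qed

locale fin_inner_product = inner_product ip
  for ip :: "'g::real_vector \<Rightarrow> 'g \<Rightarrow> real" +
  assumes fin_dim: "\<exists>B :: 'g set. finite B \<and> span B = UNIV"
begin

lemmas ip_simps =
  bilinear_ladd[OF bilinear_ip] bilinear_radd[OF bilinear_ip]
  bilinear_lsub[OF bilinear_ip] bilinear_rsub[OF bilinear_ip]
  bilinear_lneg[OF bilinear_ip] bilinear_rneg[OF bilinear_ip]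
  bilinear_lzero[OF bilinear_ip] bilinear_rzero[OF bilinear_ip]
  bilinear_lmul[OF bilinear_ip] bilinear_rmul[OF bilinear_ip]

lemma ip_linear: "linear (\<lambda>x. ip x y)" "linear (ip x)"
  using bilinear_ip by (auto simp: bilinear_def)

lemma ip_sum: "ip (sum f A) y = (\<Sum>i\<in>A. ip (f i) y)" "ip y (sum f A) = (\<Sum>i\<in>A. ip y (f i))"
  using linear_sum[OF ip_linear(1)] linear_sum[OF ip_linear(2)] by auto

lemma ip_eqI: "(\<And>z. ip x z = ip y z) \<Longrightarrow> x = y"
  using pos[of "x - y"] by (force simp: ip_simps)

lemma gram_schmidt:
  assumes "finite S"
  shows "\<exists>E. orthonormal_wrt ip E \<and> span E = span S"
  using assms
proof induction
  case empty
  show ?case by (intro exI[of _ "{}"]) (simp add: orthonormal_wrt_def)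
next
  case (insert a S)
  then obtain E where E: "orthonormal_wrt ip E" "span E = span S" by blast
  then have fin: "finite E" and on: "\<And>x y. x \<in> E \<Longrightarrow> y \<in> E \<Longrightarrow> ip x y = (if x = y then 1 else 0)"
    by (auto simp: orthonormal_wrt_def)
  define p where "p = (\<Sum>e\<in>E. ip a e *\<^sub>R e)"
  define w where "w = a - p"
  have p: "p \<in> span E" unfolding p_def by (intro span_sum span_scale span_base)
  have orth: "ip w e = 0" if "e \<in> E" for e
  proof -
    have "ip p e = (\<Sum>d\<in>E. ip a d * ip d e)" by (simp add: p_def ip_sum ip_simps)
    also have "\<dots> = (\<Sum>d\<in>E. if d = e then ip a e else 0)"
      by (rule sum.cong) (use that on in auto)
    also have "\<dots> = ip a e" using fin that by simp
    finally show ?thesis by (simp add: w_def ip_simps)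
  qed
  have sp: "span (insert a S) = span (insert w E)"
  proof -
    have "span (insert a S) = span (insert a E)"
      using E(2) by (simp add: span_insert)
    also have "\<dots> = span (insert w E)"
      unfolding w_def by (intro eq_span_insert_eq) (use p in simp)
    finally show ?thesis .
  qed
  show ?case
  proof (cases "w = 0")
    case True
    with sp E show ?thesis by (auto simp: span_insert_0)
  next
    case False
    define u where "u = (1 / sqrt (ip w w)) *\<^sub>R w"
    have pw: "ip w w > 0" by (rule pos[OF False])
    have uu: "ip u u = 1" using pw by (simp add: u_def ip_simps)
    have ue: "ip u e = 0" "ip e u = 0" if "e \<in> E" for e
      using orth[OF that] sym[of e w] by (simp_all add: u_def ip_simps)
    have "u \<notin> E" using ue(1)[of u] uu by fastforce
    have w_u: "w = sqrt (ip w w) *\<^sub>R u" using pw by (simp add: u_def)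
    have "orthonormal_wrt ip (insert u E)"
      unfolding orthonormal_wrt_def
    proof (intro conjI ballI)
      fix x y assume "x \<in> insert u E" "y \<in> insert u E"
      then consider "x = u" "y = u" | "x = u" "y \<in> E" | "x \<in> E" "y = u" | "x \<in> E" "y \<in> E"
        by blast
      then show "ip x y = (if x = y then 1 else 0)"
        using \<open>u \<notin> E\<close> by cases (auto simp: uu ue on)
    qed (simp add: fin)
    moreover have "span (insert u E) = span (insert w E)"
    proof (rule span_eq[THEN iffD2], intro conjI subsetI)
      fix x assume "x \<in> insert u E"
      then show "x \<in> span (insert w E)"
        by (auto simp: u_def intro: span_scale span_base)
    next
      fix x assume "x \<in> insert w E"
      moreover have "w \<in> span (insert u E)"
        by (subst w_u) (intro span_scale span_base insertI1)
      ultimately show "x \<in> span (insert u E)" by (auto intro: span_base)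
    qed
    ultimately show ?thesis using sp by auto
  qed
qed

definition onb where "onb = (SOME E. orthonormal_wrt ip E \<and> span E = UNIV)"

lemma orthonormal_independent:
  assumes "orthonormal_wrt ip E"
  shows "independent E"
proof -
  have fin: "finite E" and on: "\<And>x y. x \<in> E \<Longrightarrow> y \<in> E \<Longrightarrow> ip x y = (if x = y then 1 else 0)"
    using assms by (auto simp: orthonormal_wrt_def)
  show ?thesis
  proof (rule real_vector.independent_if_scalars_zero[OF fin])
    fix f x assume eq: "(\<Sum>x\<in>E. f x *\<^sub>R x) = 0" and x: "x \<in> E"
    have "0 = ip (\<Sum>x\<in>E. f x *\<^sub>R x) x" by (simp add: eq ip_simps)
    also have "\<dots> = (\<Sum>y\<in>E. f y * ip y x)" by (simp add: ip_sum ip_simps)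
    also have "\<dots> = (\<Sum>y\<in>E. if y = x then f x else 0)"
      by (rule sum.cong) (auto simp: x on)
    finally show "f x = 0" using x fin by simp
  qed
qed

lemma onb:
  shows onb_orthonormal: "orthonormal_wrt ip onb" and onb_span: "span onb = UNIV"
proof -
  obtain B :: "'g set" where B: "finite B" "span B = UNIV" using fin_dim by blast
  from gram_schmidt[OF B(1)] have "orthonormal_wrt ip onb \<and> span onb = UNIV"
    unfolding onb_def B(2) by (rule someI_ex)
  then show "orthonormal_wrt ip onb" "span onb = UNIV" by auto
qed

lemma representation_orthonormal:
  assumes E: "orthonormal_wrt ip E" "span E = UNIV" and e: "e \<in> E"
  shows "representation E x e = ip x e"
proof -
  have fin: "finite E" and on: "\<And>x y. x \<in> E \<Longrightarrow> y \<in> E \<Longrightarrow> ip x y = (if x = y then 1 else 0)"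
    using E by (auto simp: orthonormal_wrt_def)
  have "x = (\<Sum>b\<in>E. representation E x b *\<^sub>R b)"
    using real_vector.sum_representation_eq[OF orthonormal_independent[OF E(1)] _ fin order_refl, of x] E(2)
    by simp
  then have "ip x e = ip (\<Sum>b\<in>E. representation E x b *\<^sub>R b) e"
    by (rule arg_cong)
  also have "\<dots> = (\<Sum>b\<in>E. representation E x b * ip b e)"
    by (simp add: ip_sum ip_simps)
  also have "\<dots> = (\<Sum>b\<in>E. if b = e then representation E x e else 0)"
    by (rule sum.cong) (use e on in auto)
  finally show ?thesis using fin e by simp
qed

lemma expand_orthonormal:
  assumes "orthonormal_wrt ip E" "span E = UNIV"
  shows "(\<Sum>e\<in>E. ip x e *\<^sub>R e) = x"
proof -
  have "(\<Sum>e\<in>E. representation E x e *\<^sub>R e) = x"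
    using real_vector.sum_representation_eq[OF orthonormal_independent[OF assms(1)] _ _ order_refl, of x]
      assms by (simp add: orthonormal_wrt_def)
  then show ?thesis using representation_orthonormal[OF assms] by simp
qed

lemma lin_trace_orthonormal:
  assumes "orthonormal_wrt ip E" "span E = UNIV" "linear f"
  shows "lin_trace f = (\<Sum>e\<in>E. ip (f e) e)"
  using lin_trace_eq[OF assms(3) _ orthonormal_independent[OF assms(1)] assms(2)] assms
  by (simp add: orthonormal_wrt_def representation_orthonormal)

lemmas lin_trace_onb = lin_trace_orthonormal[OF onb]

lemma riesz: assumes "linear \<phi>" shows "\<exists>!w. \<forall>z. ip w z = \<phi> z"
proof (rule ex_ex1I)
  interpret linear \<phi> by fact
  have "ip (\<Sum>e\<in>onb. \<phi> e *\<^sub>R e) z = \<phi> z" for z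
  proof -
    have "\<phi> z = \<phi> (\<Sum>e\<in>onb. ip z e *\<^sub>R e)" by (simp add: expand_orthonormal[OF onb])
    then show ?thesis by (simp add: sum scale ip_sum ip_simps sym[of _ z] mult.commute)
  qed
  then show "\<exists>w. \<forall>z. ip w z = \<phi> z" by blast
qed (metis ip_eqI)

definition adj :: "('g \<Rightarrow> 'g) \<Rightarrow> 'g \<Rightarrow> 'g" where
  "adj f u = (THE w. \<forall>z. ip w z = ip u (f z))"

lemma adj_ip: assumes "linear f" shows "ip (adj f u) z = ip u (f z)"
proof -
  have "linear (\<lambda>z. ip u (f z))" using linear_compose[OF assms ip_linear(2)] by (simp add: o_def)
  from theI'[OF riesz[OF this]] show ?thesis by (simp add: adj_def)
qed

lemma adj_linear: assumes "linear f" shows "linear (adj f)"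
  by (rule linearI; rule ip_eqI) (simp_all add: adj_ip[OF assms] ip_simps)

lemma lin_trace_add:
  fixes f g :: "'g \<Rightarrow> 'g"
  assumes "linear f" "linear g"
  shows "lin_trace (\<lambda>x. f x + g x) = lin_trace f + lin_trace g"
  using assms
  by (simp add: lin_trace_onb linear_compose_add ip_simps sum.distrib)

lemma lin_trace_diff:
  fixes f g :: "'g \<Rightarrow> 'g"
  assumes "linear f" "linear g"
  shows "lin_trace (\<lambda>x. f x - g x) = lin_trace f - lin_trace g"
  using assms
  by (simp add: lin_trace_onb linear_compose_sub ip_simps sum_subtractf)

lemma lin_trace_scale:
  fixes f :: "'g \<Rightarrow> 'g"
  assumes "linear f"
  shows "lin_trace (\<lambda>x. c *\<^sub>R f x) = c * lin_trace f"
  using assms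
  by (simp add: lin_trace_onb linear_compose_scale_right ip_simps sum_distrib_left)

lemma lin_trace_adj:
  fixes f :: "'g \<Rightarrow> 'g"
  assumes "linear f"
  shows "lin_trace (adj f) = lin_trace f"
  using assms by (simp add: lin_trace_onb adj_linear adj_ip) (simp add: sym)

lemma lin_trace_comm:
  fixes f g :: "'g \<Rightarrow> 'g"
  assumes "linear f" "linear g"
  shows "lin_trace (f \<circ> g) = lin_trace (g \<circ> f)"
proof -
  have *: "(\<Sum>e\<in>onb. ip (f (g e)) e) = (\<Sum>e\<in>onb. \<Sum>d\<in>onb. ip (g e) d * ip (f d) e)"
    if "linear f" for f g :: "'g \<Rightarrow> 'g"
  proof (rule sum.cong[OF refl])
    interpret linear f by fact
    fix e
    have "f (g e) = f (\<Sum>d\<in>onb. ip (g e) d *\<^sub>R d)" by (simp add: expand_orthonormal[OF onb])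
    then show "ip (f (g e)) e = (\<Sum>d\<in>onb. ip (g e) d * ip (f d) e)"
      by (simp add: sum scale ip_sum ip_simps)
  qed
  show ?thesis
    using *[OF assms(1), of g] *[OF assms(2), of f] assms
    by (simp add: lin_trace_onb linear_compose mult.commute) (rule sum.swap)
qed

end

text \<open>The Levi-Civita connection exists and is unique, and the Ricci operator represents the Ricci
  form.\<close>

locale metric_lie_algebra = real_lie_algebra br + fin_inner_product ip
  for br :: "'g::real_vector \<Rightarrow> 'g \<Rightarrow> 'g" and ip :: "'g \<Rightarrow> 'g \<Rightarrow> real"
begin

lemmas br_simps =
  bilinear_ladd[OF bilinear_br] bilinear_radd[OF bilinear_br]
  bilinear_lsub[OF bilinear_br] bilinear_rsub[OF bilinear_br]
  bilinear_lneg[OF bilinear_br] bilinear_rneg[OF bilinear_br]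
  bilinear_lzero[OF bilinear_br] bilinear_rzero[OF bilinear_br]
  bilinear_lmul[OF bilinear_br] bilinear_rmul[OF bilinear_br]

lemma br_linear: "linear (br x)" "linear (\<lambda>x. br x y)"
  using bilinear_br by (auto simp: bilinear_def)

lemma br_swap: "br y x = - br x y"
proof -
  have "br x x + br x y + (br y x + br y y) = br (x + y) (x + y)" by (simp only: br_simps add_ac)
  then have "br x y + br y x = 0" by (simp add: alternating)
  then show ?thesis by (simp add: eq_neg_iff_add_eq_0 add.commute)
qed

definition J :: "'g \<Rightarrow> 'g \<Rightarrow> 'g" where "J u v = adj (br v) u"

lemma J_ip: "ip (J u v) z = ip u (br v z)"
  by (simp add: J_def adj_ip br_linear)

lemma adj_br_ip: "ip (adj (br u) v) z = ip v (br u z)"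
  by (simp add: adj_ip br_linear)

lemma J_linear: "linear (J u)"
  by (rule linearI; rule ip_eqI) (simp_all add: J_ip ip_simps br_simps)

lemma J_skew: "ip (J u x) y = - ip x (J u y)"
  by (simp add: J_ip sym[of x] br_swap[of y x] ip_simps)

definition koszul :: "'g \<Rightarrow> 'g \<Rightarrow> 'g" where
  "koszul u v = (1/2) *\<^sub>R (br u v - adj (br u) v - J u v)"

lemma koszul_ip: "2 * ip (koszul u v) z = ip (br u v) z - ip (br v z) u + ip (br z u) v"
  by (simp add: koszul_def ip_simps adj_br_ip J_ip sym[of u] sym[of v] br_swap[of z u])

lemma koszul_is_levi_civita: "is_levi_civita br ip koszul"
  unfolding is_levi_civita_def
proof (intro conjI allI)
  show "bilinear koszul"
    unfolding bilinear_def koszul_def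
    by (intro conjI allI; rule linearI; rule ip_eqI)
      (simp_all add: ip_simps adj_br_ip J_ip br_simps algebra_simps)
  show "koszul x y - koszul y x = br x y" for x y
  proof (rule ip_eqI)
    fix z
    have "2 * ip (koszul x y - koszul y x) z = 2 * ip (br x y) z"
      using koszul_ip[of x y z] koszul_ip[of y x z]
      by (simp add: ip_simps br_swap[of y x] br_swap[of z])
    then show "ip (koszul x y - koszul y x) z = ip (br x y) z" by simp
  qed
  show "ip (koszul x y) z + ip y (koszul x z) = 0" for x y z
    using koszul_ip[of x y z] koszul_ip[of x z y]
    by (simp add: sym[of y] br_swap[of z] br_swap[of y x] ip_simps)
qed

lemma is_levi_civita_unique:
  assumes "is_levi_civita br ip N"
  shows "N = koszul"
proof (intro ext ip_eqI)
  fix u v z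
  have t: "N x y - N y x = br x y" and m: "ip (N x y) z + ip y (N x z) = 0" for x y z
    using assms by (auto simp: is_levi_civita_def)
  have "ip (br u v) z = ip (N u v) z - ip (N v u) z" "ip (br v z) u = ip (N v z) u - ip (N z v) u"
       "ip (br z u) v = ip (N z u) v - ip (N u z) v"
    by (simp_all add: t[symmetric] ip_simps)
  with m[of u v z] m[of v z u] m[of z u v] koszul_ip[of u v z]
    sym[of v "N u z"] sym[of z "N v u"] sym[of u "N z v"]
  show "ip (N u v) z = ip (koszul u v) z"
    by linarith
qed

lemma levi_civita_eq: "levi_civita br ip = koszul"
  unfolding levi_civita_def
  by (rule the_equality, rule koszul_is_levi_civita, erule is_levi_civita_unique)

lemma koszul_bilinear: "bilinear koszul"
  using koszul_is_levi_civita unfolding is_levi_civita_def by blast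

lemmas koszul_simps =
  bilinear_ladd[OF koszul_bilinear] bilinear_radd[OF koszul_bilinear]
  bilinear_lmul[OF koszul_bilinear] bilinear_rmul[OF koszul_bilinear]

lemma curvature_linear: "linear (\<lambda>x. curvature br ip x u v)" "linear (curvature br ip x u)"
  by (auto intro!: linearI simp: curvature_def Let_def levi_civita_eq koszul_simps br_simps algebra_simps)

lemma ricci_linear: "linear (ricci br ip u)"
proof (rule linearI)
  fix v w :: 'g and c :: real
  have "ricci br ip u (v + w) = lin_trace (\<lambda>x. curvature br ip x u v + curvature br ip x u w)"
    by (simp only: ricci_def linear_add[OF curvature_linear(2)])
  then show "ricci br ip u (v + w) = ricci br ip u v + ricci br ip u w"
    by (simp only: ricci_def lin_trace_add[OF curvature_linear(1) curvature_linear(1)])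
  have "ricci br ip u (c *\<^sub>R v) = lin_trace (\<lambda>x. c *\<^sub>R curvature br ip x u v)"
    by (simp only: ricci_def linear_cmul[OF curvature_linear(2)])
  then show "ricci br ip u (c *\<^sub>R v) = c *\<^sub>R ricci br ip u v"
    by (simp only: ricci_def lin_trace_scale[OF curvature_linear(1)] real_scaleR_def)
qed

lemma ricci_op_ip: "ricci br ip u v = ip (ricci_op br ip u) v"
proof -
  have "\<exists>!w. \<forall>v. ricci br ip u v = ip w v"
    using riesz[OF ricci_linear[of u]] by metis
  from theI'[OF this] show ?thesis unfolding ricci_op_def by (rule spec)
qed

text \<open>On a 2-step nilpotent Lie algebra, \<open>ad\<close> and the products \<open>ad \<circ> ad\<close> are trace-free, so the Ricci form
  is given by the trace formula \<open>ricci_trace_formula\<close>.\<close>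

lemma lin_trace_nilsquare:
  fixes f :: "'g \<Rightarrow> 'g"
  assumes f: "linear f" and "\<And>x. f (f x) = 0"
  shows "lin_trace f = 0"
proof -
  obtain S :: "'g set" where S: "finite S" "span S = UNIV" using fin_dim by auto
  obtain A where A: "A \<subseteq> range f" "independent A" "span A = span (range f)"
    using real_vector.maximal_independent_subset[of "range f"]
    by (metis real_vector.span_eq real_vector.span_mono real_vector.span_superset order_trans)
  define B where "B = extend_basis A"
  have B: "A \<subseteq> B" "independent B" "span B = UNIV"
    using A by (simp_all add: B_def extend_basis_superset independent_extend_basis)
  have fB: "finite B" using independent_span_bound[OF S(1) B(2)] S(2) by simp
  have "representation B (f b) b = 0" if "b \<in> B" for b
  proof (cases "b \<in> A")
    case True
    then show ?thesis using A(1) assms(2) by (auto simp: representation_zero)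
  next
    case False
    have "f b \<in> span A" using A(3) by (auto intro: span_base)
    then have "representation B (f b) = representation A (f b)"
      by (rule representation_extend[OF B(2) _ B(1)])
    then show ?thesis using False representation_ne_zero[of A "f b" b] by auto
  qed
  then show ?thesis by (simp add: lin_trace_eq[OF f fB B(2,3)])
qed

lemma ricci_trace_formula:
  assumes unimodular: "\<And>x. lin_trace (br x) = 0"
    and killing: "\<And>x y. lin_trace (br x \<circ> br y) = 0"
  shows "ricci br ip u v = - (1/2) * lin_trace (br u \<circ> adj (br v)) - (1/4) * lin_trace (J u \<circ> J v)"
proof -
  define t :: "('g \<Rightarrow> 'g) \<Rightarrow> ('g \<Rightarrow> 'g) \<Rightarrow> real" where "t f g = lin_trace (f \<circ> g)" for f g
  define A where "A x y = br x y + adj (br x) y + J x y" for x y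
  note lin = br_linear(1) adj_linear[OF br_linear(1)] J_linear
  have A_linear: "linear (A x)" for x
    unfolding A_def by (intro linear_compose_add lin)
  have t_onb: "t f g = (\<Sum>e\<in>onb. ip (f (g e)) e)" if "linear f" "linear g" for f g
    using that by (simp add: t_def lin_trace_onb linear_compose)
  have t_comm: "t f g = t g f" if "linear f" "linear g" for f g
    unfolding t_def by (rule lin_trace_comm[OF that])
  have t_adj: "t (adj f) g = t f (adj g)" if f: "linear f" and g: "linear g" for f g
  proof -
    have "t (adj f) g = (\<Sum>e\<in>onb. ip (adj g (f e)) e)"
      using f g by (simp add: t_onb adj_linear adj_ip) (simp add: sym)
    also have "\<dots> = t (adj g) f" using f g by (simp add: t_onb adj_linear)
    also have "\<dots> = t f (adj g)" using f g by (simp add: t_comm adj_linear)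
    finally show ?thesis .
  qed
  have adj_adj: "adj (adj f) = f" if "linear f" for f
    by (rule ext, rule ip_eqI) (simp add: adj_ip that adj_linear sym[of _ "adj f _"], simp add: sym)
  have adj_J: "adj (J x) = (\<lambda>y. - J x y)" for x
    by (rule ext, rule ip_eqI) (simp add: adj_ip J_linear ip_simps J_skew)
  have t_A: "t (A x) g = t (br x) g + t (adj (br x)) g + t (J x) g" if "linear g" for x g
    using that by (simp add: t_onb A_linear lin A_def ip_simps sum.distrib)
  have t_neg: "t f (\<lambda>y. - g y) = - t f g" if "linear f" "linear g" for f g
    using that by (simp add: t_onb linear_compose_neg linear_neg ip_simps sum_negf)
  have t_JS: "t (br x) (J y) + t (adj (br x)) (J y) = 0" for x y
    by (simp add: t_adj lin adj_J t_neg)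
  have "t (A u) (A v) = t (br u) (A v) + t (adj (br u)) (A v) + t (J u) (A v)"
    by (rule t_A[OF A_linear])
  also have "\<dots> = t (A v) (br u) + t (A v) (adj (br u)) + t (A v) (J u)"
    by (simp add: t_comm lin A_linear)
  also have "\<dots> = (t (br v) (br u) + t (adj (br v)) (adj (br u)))
      + (t (br v) (adj (br u)) + t (adj (br v)) (br u)) + t (J v) (J u)
      + (t (br v) (J u) + t (adj (br v)) (J u)) + (t (J v) (br u) + t (J v) (adj (br u)))"
    by (simp add: t_A lin)
  also have "\<dots> = 2 * t (br u) (adj (br v)) + t (J u) (J v)"
  proof -
    have "t (br v) (br u) = 0" using killing by (simp add: t_def)
    moreover have "t (adj (br v)) (adj (br u)) = t (br v) (br u)"
      by (simp add: t_adj lin adj_adj br_linear)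
    moreover have "t (br v) (adj (br u)) = t (br u) (adj (br v))" "t (adj (br v)) (br u) = t (br u) (adj (br v))"
      using t_adj[OF br_linear(1) br_linear(1), of u v] t_comm[OF lin(2) lin(1), of v u]
        t_comm[OF lin(2) lin(1), of u v] by simp_all
    moreover have "t (J v) (br u) + t (J v) (adj (br u)) = 0"
      using t_JS[of u v] by (simp add: t_comm lin)
    ultimately show ?thesis using t_JS[of v u] t_comm[OF lin(3) lin(3), of v u] by simp
  qed
  finally have AA: "t (A u) (A v) = 2 * t (br u) (adj (br v)) + t (J u) (J v)" .
  have N: "koszul x w = - (1/2) *\<^sub>R A w x" for x w
  proof (rule ip_eqI)
    fix z show "ip (koszul x w) z = ip (- (1/2) *\<^sub>R A w x) z"
      using koszul_ip[of x w z] sym[of "br w z" x] sym[of "br z x" w] sym[of "br x z" w]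
      by (simp add: A_def ip_simps adj_br_ip J_ip br_swap[of x w] br_swap[of z x] field_simps)
  qed
  have N': "koszul u x = br u x - (1/2) *\<^sub>R A u x" for x
  proof -
    have "(2::real) *\<^sub>R koszul u x = (2::real) *\<^sub>R (br u x - (1/2) *\<^sub>R A u x)"
      unfolding koszul_def A_def J_def by (simp add: scaleR_2 scaleR_diff_right)
    then show ?thesis by simp
  qed
  have skew: "(\<Sum>e\<in>onb. ip (koszul e (koszul u v)) e) = 0"
  proof -
    have "ip (koszul e w) e = - ip (br w e) e" for e w
      using koszul_ip[of e w e] by (simp add: br_swap[of e w] alternating ip_simps)
    then show ?thesis
      using unimodular[of "koszul u v"] by (simp add: lin_trace_onb br_linear sum_negf)
  qed
  have "ricci br ip u v = (\<Sum>e\<in>onb. ip (curvature br ip e u v) e)"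
    by (simp add: ricci_def lin_trace_onb curvature_linear)
  also have "\<dots> = (\<Sum>e\<in>onb. ip (koszul e (koszul u v)) e - ip (koszul u (koszul e v)) e
      - ip (koszul (br e u) v) e)"
    by (simp add: curvature_def Let_def levi_civita_eq ip_simps)
  also have "\<dots> = (\<Sum>e\<in>onb. - ip (koszul u (koszul e v)) e - ip (koszul (br e u) v) e)"
    using skew by (simp add: sum_subtractf sum_negf)
  also have "\<dots> = (\<Sum>e\<in>onb. (1/2) * ip (br u (A v e)) e - (1/4) * ip (A u (A v e)) e
      - (1/2) * ip (A v (br u e)) e)"
  proof (rule sum.cong[OF refl])
    fix e
    have "koszul (br e u) v = (1/2) *\<^sub>R A v (br u e)"
      by (simp add: N br_swap[of e u] linear_neg[OF A_linear])
    moreover have "koszul u (koszul e v) = - (1/2) *\<^sub>R (br u (A v e) - (1/2) *\<^sub>R A u (A v e))"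
      unfolding N[of e v] by (simp only: bilinear_rmul[OF koszul_bilinear] N')
    ultimately show "- ip (koszul u (koszul e v)) e - ip (koszul (br e u) v) e
      = (1/2) * ip (br u (A v e)) e - (1/4) * ip (A u (A v e)) e - (1/2) * ip (A v (br u e)) e"
      by (simp add: ip_simps)
  qed
  also have "\<dots> = (1/2) * t (br u) (A v) - (1/4) * t (A u) (A v) - (1/2) * t (A v) (br u)"
    by (simp add: t_onb A_linear br_linear sum_subtractf sum_distrib_left)
  also have "\<dots> = - (1/2) * t (br u) (adj (br v)) - (1/4) * t (J u) (J v)"
    using t_comm[OF A_linear br_linear(1), of v u] by (simp add: AA field_simps)
  finally show ?thesis by (simp add: t_def)
qed

end

lemma A51_frame_induct:
  assumes "A51_frame br v \<alpha> \<beta> \<gamma>" "subspace {x. P x}" "\<And>i. i \<in> {1..5} \<Longrightarrow> P (v i)"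
  shows "P x"
proof -
  have "v ` {1..5} \<subseteq> {x. P x}" using assms(3) by blast
  then have "span (v ` {1..5}) \<subseteq> {x. P x}" using assms(2) by (rule span_minimal)
  moreover have "span (v ` {1..5}) = UNIV" using assms(1) unfolding A51_frame_def by blast
  ultimately show ?thesis by blast
qed

lemma (in real_lie_algebra) A51_two_step:
  fixes x y z :: 'g
  assumes v: "A51_frame br v \<alpha> \<beta> \<gamma>"
  shows "br (br x y) z = 0"
proof -
  have swap: "br a b = - br b a" for a b
  proof -
    have "br (a + b) (a + b) = br a a + br b a + (br a b + br b b)"
      by (simp only: bilinear_ladd[OF bilinear_br] bilinear_radd[OF bilinear_br] add_ac)
    then show ?thesis by (simp add: alternating eq_neg_iff_add_eq_0 add.commute[of "br a b"])
  qed
  have lin: "linear (br a)" "linear (\<lambda>a. br a b)" for a b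
    using bilinear_br by (auto simp: bilinear_def)
  have sub0: "subspace {x. f x = 0}" if "linear f" for f :: "'g \<Rightarrow> 'g"
    using that by (rule linear_subspace_kernel)
  have 0: "br (v i) (v j) = 0" if "i \<in> {4,5}" "j \<in> {1..5}" for i j
  proof -
    have *: "\<And>i j. 1 \<le> i \<and> i < j \<and> j \<le> 5 \<and> (i, j) \<noteq> (1, 2) \<and> (i, j) \<noteq> (1, 3) \<Longrightarrow> br (v i) (v j) = 0"
      using v by (simp add: A51_frame_def)
    consider "i < j" | "i = j" | "j < i" by linarith
    then show ?thesis
    proof cases
      case 1 then show ?thesis using that by (intro *) auto
    next
      case 2 then show ?thesis by (simp add: alternating)
    next
      case 3 then have "br (v j) (v i) = 0" using that by (intro *) auto
      then show ?thesis by (simp add: swap[of "v i" "v j"])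
    qed
  qed
  have central: "br (v i) z = 0" if "i \<in> {4,5}" for i z
    by (rule A51_frame_induct[OF v sub0[OF lin(1)]]) (use 0 that in auto)
  define W where "W = span {v 4, v 5}"
  have W0: "br w z = 0" if "w \<in> W" for w z
    using that unfolding W_def
  proof (induction rule: span_induct)
    case base
    show ?case by (rule sub0[OF lin(2)])
  next
    case (step w)
    then show ?case using central by blast
  qed
  have vv: "br (v i) (v j) \<in> W" if "i \<in> {1..5}" "j \<in> {1..5}" for i j
  proof -
    have *: "br (v i) (v j) \<in> W" if "1 \<le> i" "i < j" "j \<le> 5" for i j
    proof (cases "(i, j) = (1, 2) \<or> (i, j) = (1, 3)")
      case True
      moreover have "br (v 1) (v 2) = \<alpha> *\<^sub>R v 4 + \<beta> *\<^sub>R v 5" "br (v 1) (v 3) = \<gamma> *\<^sub>R v 5"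
        using v unfolding A51_frame_def by blast+
      moreover have "v 4 \<in> W" "v 5 \<in> W" by (auto simp: W_def intro: span_base)
      then have "\<alpha> *\<^sub>R v 4 + \<beta> *\<^sub>R v 5 \<in> W" "\<gamma> *\<^sub>R v 5 \<in> W"
        unfolding W_def by (simp_all add: span_add span_scale)
      ultimately show ?thesis by (elim disjE) simp_all
    next
      case False
      with that v have "br (v i) (v j) = 0" unfolding A51_frame_def by blast
      then show ?thesis by (simp add: W_def span_zero)
    qed
    consider "i < j" | "i = j" | "j < i" by linarith
    then show ?thesis
    proof cases
      case 1 then show ?thesis using that by (intro *) auto
    next
      case 2 then show ?thesis by (simp add: alternating W_def span_zero)
    next
      case 3 then have "br (v j) (v i) \<in> W" using that by (intro *) auto
      then show ?thesis by (simp add: swap[of "v i" "v j"] W_def span_neg)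
    qed
  qed
  have subW: "subspace {x. f x \<in> W}" if "linear f" for f :: "'g \<Rightarrow> 'g"
    using linear_subspace_vimage[OF that, of W] by (simp add: W_def vimage_def)
  have "br (v i) y \<in> W" if "i \<in> {1..5}" for i y
    by (rule A51_frame_induct[OF v subW[OF lin(1)]]) (use vv that in auto)
  then have "br x y \<in> W"
    by (rule A51_frame_induct[OF v subW[OF lin(2)], rotated])
  then show ?thesis by (rule W0)
qed

lemma A51_frame_normalise:
  fixes br :: "'g::real_vector \<Rightarrow> 'g \<Rightarrow> 'g"
  assumes "real_lie_algebra br" and v: "A51_frame br v \<alpha> \<beta> \<gamma>" and "\<alpha> > 0" "\<gamma> > 0"
  defines "e \<equiv> v(4 := \<alpha> *\<^sub>R v 4 + \<beta> *\<^sub>R v 5, 5 := \<gamma> *\<^sub>R v 5)"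
  shows "A51_frame br e 1 0 1"
proof -
  interpret real_lie_algebra br by fact
  have I: "{1..5} = {1,2,3,4,5::nat}" by auto
  let ?V = "v ` {1..5}" and ?E = "e ` {1..5}"
  have V: "inj_on v {1..5}" "independent ?V" "span ?V = UNIV" using v by (auto simp: A51_frame_def)
  have cV: "card ?V = 5" using V(1) by (simp add: card_image)
  have "?V \<subseteq> span ?E"
  proof -
    have eE: "e i \<in> span ?E" if "i \<in> {1..5}" for i using that by (intro span_base) auto
    have "(1 / \<gamma>) *\<^sub>R e 5 = v 5" using \<open>\<gamma> > 0\<close> by (simp add: e_def)
    then have 5: "v 5 \<in> span ?E" using span_scale[OF eE[of 5], of "1 / \<gamma>"] by simp
    have "(1 / \<alpha>) *\<^sub>R (e 4 - \<beta> *\<^sub>R v 5) = v 4" using \<open>\<alpha> > 0\<close> by (simp add: e_def)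
    then have 4: "v 4 \<in> span ?E"
      using span_scale[OF span_diff[OF eE[of 4] span_scale[OF 5, of \<beta>]], of "1 / \<alpha>"] by simp
    have "v 1 \<in> span ?E" "v 2 \<in> span ?E" "v 3 \<in> span ?E"
      using eE[of 1] eE[of 2] eE[of 3] by (simp_all add: e_def)
    moreover have "?V = {v 1, v 2, v 3, v 4, v 5}" unfolding I by simp
    ultimately show ?thesis using 4 5 by (simp only: insert_subset empty_subsetI simp_thms)
  qed
  then have spE: "span ?E = UNIV" using V(3) span_minimal[of ?V "span ?E"] by auto
  have bound: "5 \<le> card S" if "finite S" "span S = UNIV" for S :: "'g set"
    using independent_span_bound[OF that(1) V(2)] that cV by auto
  have "card ?E \<le> 5" using card_image_le[of "{1..5::nat}" e] by simp
  with bound[of ?E] spE have cE: "card ?E = 5" by simp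
  then have inj: "inj_on e {1..5}" by (intro eq_card_imp_inj_on) auto
  have ind: "independent ?E"
  proof
    assume "dependent ?E"
    then obtain a where a: "a \<in> ?E" "a \<in> span (?E - {a})" by (auto simp: dependent_def)
    then have "span (?E - {a}) = UNIV" using spE span_redundant[of a "?E - {a}"] by (simp add: insert_absorb)
    then have "5 \<le> card (?E - {a})" by (intro bound) auto
    moreover have "card (?E - {a}) = 4" using a(1) cE by (subst card_Diff_singleton) auto
    ultimately show False by linarith
  qed
  have *: "\<And>i j. 1 \<le> i \<and> i < j \<and> j \<le> 5 \<and> (i, j) \<noteq> (1, 2) \<and> (i, j) \<noteq> (1, 3) \<Longrightarrow> br (v i) (v j) = 0"
    using v by (simp add: A51_frame_def)
  have br0: "br (v 1) (v 4) = 0" "br (v 1) (v 5) = 0" "br (v 2) (v 3) = 0" "br (v 2) (v 4) = 0"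
      "br (v 2) (v 5) = 0" "br (v 3) (v 4) = 0" "br (v 3) (v 5) = 0" "br (v 4) (v 5) = 0"
    using *[of 1 4] *[of 1 5] *[of 2 3] *[of 2 4] *[of 2 5] *[of 3 4] *[of 3 5] *[of 4 5]
    by simp_all
  have "br (e i) (e j) = 0" if "1 \<le> i" "i < j" "j \<le> 5" "(i, j) \<noteq> (1, 2)" "(i, j) \<noteq> (1, 3)" for i j
  proof -
    have "i = 1 \<or> i = 2 \<or> i = 3 \<or> i = 4" "j = 2 \<or> j = 3 \<or> j = 4 \<or> j = 5"
      using that(1-3) by presburger+
    then have "(i, j) \<in> {(1,4), (1,5), (2,3), (2,4), (2,5), (3,4), (3,5), (4,5)}"
      using that(2,4,5) by (elim disjE) simp_all
    then show ?thesis
      using br0 by (elim insertE emptyE) (simp_all add: e_def alternating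
        bilinear_ladd[OF bilinear_br] bilinear_radd[OF bilinear_br]
        bilinear_lmul[OF bilinear_br] bilinear_rmul[OF bilinear_br])
  qed
  then have zero: "\<forall>i j. 1 \<le> i \<and> i < j \<and> j \<le> 5 \<and> (i, j) \<noteq> (1, 2) \<and> (i, j) \<noteq> (1, 3)
      \<longrightarrow> br (e i) (e j) = 0"
    by blast
  have e: "e 1 = v 1" "e 2 = v 2" "e 3 = v 3"
      "e 4 = \<alpha> *\<^sub>R v 4 + \<beta> *\<^sub>R v 5" "e 5 = \<gamma> *\<^sub>R v 5"
    by (simp_all add: e_def)
  have "br (v 1) (v 2) = \<alpha> *\<^sub>R v 4 + \<beta> *\<^sub>R v 5" "br (v 1) (v 3) = \<gamma> *\<^sub>R v 5"
    using v unfolding A51_frame_def by blast+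
  then have "br (e 1) (e 2) = 1 *\<^sub>R e 4 + 0 *\<^sub>R e 5" "br (e 1) (e 3) = 1 *\<^sub>R e 5"
    unfolding e by simp_all
  then show ?thesis
    unfolding A51_frame_def by (intro conjI inj ind spE zero)
qed

lemma is_A51_iff:
  "is_A51 br \<longleftrightarrow> real_lie_algebra br \<and> (\<exists>e \<alpha> \<beta> \<gamma>. \<alpha> > 0 \<and> \<gamma> > 0 \<and> A51_frame br e \<alpha> \<beta> \<gamma>)"
proof
  assume "is_A51 br"
  then show "real_lie_algebra br \<and> (\<exists>e \<alpha> \<beta> \<gamma>. \<alpha> > 0 \<and> \<gamma> > 0 \<and> A51_frame br e \<alpha> \<beta> \<gamma>)"
    unfolding is_A51_def using zero_less_one by blast
qed (auto simp: is_A51_def intro: A51_frame_normalise)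

lemma A51_metric_lie_algebra:
  assumes "is_A51 br" "inner_product ip"
  shows "metric_lie_algebra br ip"
proof -
  obtain e where e: "A51_frame br e 1 0 1" and br: "real_lie_algebra br"
    using assms by (auto simp: is_A51_def)
  have "finite (e ` {1..5}) \<and> span (e ` {1..5}) = UNIV" using e by (simp add: A51_frame_def)
  then show ?thesis
    using br assms(2)
    by (auto intro!: metric_lie_algebra.intro fin_inner_product.intro fin_inner_product_axioms.intro)
qed

theorem A51_ricci:
  assumes A: "is_A51 br" and ip: "inner_product ip"
  shows "ricci br ip u v = - (1/2) * lin_trace (br u \<circ> fin_inner_product.adj ip (br v))
      - (1/4) * lin_trace (metric_lie_algebra.J br ip u \<circ> metric_lie_algebra.J br ip v)"
proof -
  interpret metric_lie_algebra br ip by (rule A51_metric_lie_algebra[OF assms])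
  have two: "br x (br y z) = 0" for x y z
    using A A51_two_step br_swap[of "br y z" x] by (auto simp: is_A51_def)
  have "lin_trace (br x) = 0" for x by (rule lin_trace_nilsquare[OF br_linear(1) two])
  moreover have "lin_trace (br x \<circ> br y) = 0" for x y
    by (rule lin_trace_nilsquare) (simp_all add: linear_compose br_linear two bilinear_rzero[OF bilinear_br])
  ultimately show ?thesis by (rule ricci_trace_formula)
qed

end

theory Submission
  imports Defs
begin

text \<open>Rescaling the frame by \<open>sqrt \<eta>\<close> makes it orthonormal for the given inner product and multiplies
  the structure constants by \<open>sqrt \<eta>\<close>, so one may take \<open>\<eta> = 1\<close>.  The trace formula then gives the Ricci
  operator in the frame.  Its shift \<open>D\<close> by \<open>k\<close> maps \<open>[v\<^sub>1, v\<^sub>3] = \<gamma> v\<^sub>5\<close> to a vector with \<open>v\<^sub>4\<close>-component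
  \<open>\<alpha>\<beta>\<gamma>/2\<close>, whereas the Leibniz rule predicts \<open>- \<alpha>\<beta>\<gamma>/2\<close>; hence \<open>\<beta> = 0\<close>.  Then \<open>D\<close> is diagonal, and the
  Leibniz rule on \<open>[v\<^sub>1, v\<^sub>2]\<close> and \<open>[v\<^sub>1, v\<^sub>3]\<close> says \<open>\<alpha>\<^sup>2 = \<gamma>\<^sup>2 = - (\<alpha>\<^sup>2 + \<gamma>\<^sup>2)/2 - k\<close>.\<close>

context metric_lie_algebra
begin

text \<open>Both traces are evaluated over \<open>E\<close>: cyclicity moves the adjoint to the
  front in the first, and skewness of \<open>J u\<close> with the expansion of \<open>J w x\<close>
  in \<open>E\<close> handles the second. No adjoints remain, so structure constants
  suffice.\<close>

lemma ricci_orthonormal: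
  assumes A51: "is_A51 br" and E: "orthonormal_wrt ip E" "span E = UNIV"
  shows "ricci br ip u w = (1/4) * (\<Sum>x\<in>E. \<Sum>y\<in>E. ip u (br x y) * ip w (br x y))
      - (1/2) * (\<Sum>x\<in>E. ip (br u x) (br w x))"
proof -
  have "lin_trace (br u \<circ> adj (br w)) = lin_trace (adj (br w) \<circ> br u)"
    by (simp add: lin_trace_comm br_linear adj_linear)
  also have "\<dots> = (\<Sum>x\<in>E. ip (br u x) (br w x))"
    by (simp add: lin_trace_orthonormal[OF E] linear_compose br_linear adj_linear adj_br_ip)
  finally have 1: "lin_trace (br u \<circ> adj (br w)) = (\<Sum>x\<in>E. ip (br u x) (br w x))" .
  have "ip (J u x) (J w x) = (\<Sum>y\<in>E. ip u (br x y) * ip w (br x y))" for x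
  proof -
    have "ip (J u x) (J w x) = ip (J u x) (\<Sum>y\<in>E. ip (J w x) y *\<^sub>R y)"
      by (simp only: expand_orthonormal[OF E])
    also have "\<dots> = (\<Sum>y\<in>E. ip u (br x y) * ip w (br x y))"
      by (simp add: ip_sum ip_simps J_ip mult.commute)
    finally show ?thesis .
  qed
  then have 2: "lin_trace (J u \<circ> J w) = - (\<Sum>x\<in>E. \<Sum>y\<in>E. ip u (br x y) * ip w (br x y))"
    by (simp add: lin_trace_orthonormal[OF E] linear_compose J_linear sum_negf
        J_skew[of u "J w _"] sym[of "J w _"])
  show ?thesis
    using A51_ricci[OF A51 inner_product_axioms, of u w] 1 2 by simp
qed

text \<open>The Ricci form is symmetric, so \<open>ricci_op\<close> is self-adjoint; its argument
  can then be moved into a linear slot of \<open>ip\<close>.\<close>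

lemma ricci_op_linear:
  assumes "is_A51 br"
  shows "linear (ricci_op br ip)"
proof -
  have ricci_sym: "ricci br ip u w = ricci br ip w u" for u w
    by (simp add: ricci_orthonormal[OF assms onb] mult.commute sym[of "br u _"])
  have swap: "ip (ricci_op br ip x) y = ip (ricci_op br ip y) x" for x y
    using ricci_sym by (simp flip: ricci_op_ip)
  show ?thesis
    by (rule linearI; rule ip_eqI) (simp_all add: ip_simps swap[of _ z for z])
qed

end

text \<open>The Leibniz defect is bilinear, so span induction in \<open>y\<close> and then in
  \<open>x\<close> reduces it to frame vectors.\<close>

lemma derivation_A51_frameI:
  assumes br: "bilinear br" and v: "A51_frame br v \<alpha> \<beta> \<gamma>" and D: "linear D"
    and frame: "\<And>i j. i \<in> {1..5} \<Longrightarrow> j \<in> {1..5} \<Longrightarrow>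
      D (br (v i) (v j)) = br (D (v i)) (v j) + br (v i) (D (v j))"
  shows "derivation br D"
proof -
  note lin = bilinear_ladd[OF br] bilinear_radd[OF br] bilinear_lzero[OF br] bilinear_rzero[OF br]
    bilinear_lmul[OF br] bilinear_rmul[OF br]
    linear_add[OF D] linear_cmul[OF D] linear_0[OF D] scaleR_add_right
  have 1: "D (br (v i) y) = br (D (v i)) y + br (v i) (D y)" if "i \<in> {1..5}" for i y
    by (rule A51_frame_induct[OF v, where P = "\<lambda>y. D (br (v i) y) = br (D (v i)) y + br (v i) (D y)"])
      (use that in \<open>auto simp: subspace_def lin frame\<close>)
  have "D (br x y) = br (D x) y + br x (D y)" for x y
    by (rule A51_frame_induct[OF v, where P = "\<lambda>x. D (br x y) = br (D x) y + br x (D y)"])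
      (auto simp: subspace_def lin 1)
  with D show ?thesis by (simp add: derivation_def)
qed

locale orthonormal_A51_frame = metric_lie_algebra +
  fixes e :: "nat \<Rightarrow> 'a" and a b c :: real
  assumes frame: "A51_frame br e a b c"
    and orthonormal: "i \<in> {1..5} \<Longrightarrow> j \<in> {1..5} \<Longrightarrow> ip (e i) (e j) = (if i = j then 1 else 0)"
    and a_pos: "a > 0" and c_pos: "c > 0"
begin

text \<open>Keeps the index \<open>1\<close> from turning into \<open>Suc 0\<close>, so that rules
  about \<open>e 1\<close> still match.\<close>

declare One_nat_def [simp del]

lemma A51: "is_A51 br"
  using is_A51_iff frame a_pos c_pos real_lie_algebra_axioms by blast

lemma orthonormal_image: "orthonormal_wrt ip (e ` {1..5})" "span (e ` {1..5}) = UNIV"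
  using frame by (auto simp: A51_frame_def orthonormal_wrt_def orthonormal inj_on_eq_iff)

lemma index: "{1..5} = {1, 2, 3, 4, 5::nat}"
  by auto

lemma sum_frame: "(\<Sum>x\<in>e ` {1..5}. f x) = f (e 1) + f (e 2) + f (e 3) + f (e 4) + f (e 5)"
proof -
  have "(\<Sum>x\<in>e ` {1..5}. f x) = (\<Sum>i\<in>{1..5}. f (e i))"
    using frame by (simp add: A51_frame_def sum.reindex)
  then show ?thesis by (simp add: index add.assoc)
qed

lemma br_frame:
  "br (e 1) (e 2) = a *\<^sub>R e 4 + b *\<^sub>R e 5" "br (e 2) (e 1) = - (a *\<^sub>R e 4 + b *\<^sub>R e 5)"
  "br (e 1) (e 3) = c *\<^sub>R e 5" "br (e 3) (e 1) = - (c *\<^sub>R e 5)"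
  using frame br_swap[of "e 2" "e 1"] br_swap[of "e 3" "e 1"] by (auto simp: A51_frame_def)

lemma br_frame_0:
  assumes "i \<in> {1..5}" "j \<in> {1..5}"
    and "(i, j) \<notin> {(1, 2), (2, 1), (1, 3), (3, 1)}"
  shows "br (e i) (e j) = 0"
proof -
  have *: "br (e i) (e j) = 0"
    if "1 \<le> i" "i < j" "j \<le> 5" "(i, j) \<noteq> (1, 2)" "(i, j) \<noteq> (1, 3)" for i j
    using frame that by (simp add: A51_frame_def)
  consider "i < j" | "i = j" | "j < i" by linarith
  then show ?thesis
  proof cases
    case 1 then show ?thesis using assms by (intro *) auto
  next
    case 2 then show ?thesis by (simp add: alternating)
  next
    case 3
    then have "br (e j) (e i) = 0" using assms by (intro *) auto
    then show ?thesis by (simp add: br_swap[of "e i" "e j"])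
  qed
qed

lemmas frame_simps = br_frame br_frame_0 orthonormal ip_simps br_simps

lemma ricci_op_expand:
  "ricci_op br ip u = ricci br ip u (e 1) *\<^sub>R e 1 + ricci br ip u (e 2) *\<^sub>R e 2
    + ricci br ip u (e 3) *\<^sub>R e 3 + ricci br ip u (e 4) *\<^sub>R e 4 + ricci br ip u (e 5) *\<^sub>R e 5"
  using expand_orthonormal[OF orthonormal_image, of "ricci_op br ip u"]
  by (simp add: sum_frame ricci_op_ip)

text \<open>The double sum in \<open>ricci_orthonormal\<close> sees only components along
  \<open>e 4\<close> and \<open>e 5\<close>, while the single sum vanishes on these central vectors.
  Hence the block form.\<close>

lemma ricci_op_frame:
  "ricci_op br ip (e 1) = - ((a\<^sup>2 + b\<^sup>2 + c\<^sup>2) / 2) *\<^sub>R e 1"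
  "ricci_op br ip (e 2) = - ((a\<^sup>2 + b\<^sup>2) / 2) *\<^sub>R e 2 - (b * c / 2) *\<^sub>R e 3"
  "ricci_op br ip (e 3) = - (b * c / 2) *\<^sub>R e 2 - (c\<^sup>2 / 2) *\<^sub>R e 3"
  "ricci_op br ip (e 4) = (a\<^sup>2 / 2) *\<^sub>R e 4 + (a * b / 2) *\<^sub>R e 5"
  "ricci_op br ip (e 5) = (a * b / 2) *\<^sub>R e 4 + ((b\<^sup>2 + c\<^sup>2) / 2) *\<^sub>R e 5"
  by (simp_all add: ricci_op_expand ricci_orthonormal[OF A51 orthonormal_image] sum_frame
      frame_simps power2_eq_square field_simps)

lemma schouten_soliton_iff: "algebraic_schouten_soliton br ip \<longleftrightarrow> b = 0 \<and> a = c"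
proof
  assume "algebraic_schouten_soliton br ip"
  then obtain k where D: "derivation br (\<lambda>u. ricci_op br ip u - k *\<^sub>R u)" (is "derivation br ?D")
    by (auto simp: algebraic_schouten_soliton_def)
  note Ric = linear_add[OF ricci_op_linear[OF A51]] linear_cmul[OF ricci_op_linear[OF A51]]
    ricci_op_frame
  have leibniz: "ip (?D (br x y)) z = ip (br (?D x) y + br x (?D y)) z" for x y z
    using D by (simp add: derivation_def)
  \<comment> \<open>The \<open>e 2\<close> term of the Ricci image of \<open>e 3\<close> is
    bracketed with \<open>e 1\<close> into \<open>e 4\<close>.\<close>
  from leibniz[of "e 1" "e 3" "e 4"] have "a * b * c = 0"
    by (simp add: Ric frame_simps field_simps)
  then have b: "b = 0" using a_pos c_pos by simp
  from leibniz[of "e 1" "e 2" "e 4"] have "a * (a\<^sup>2 / 2 - k) = a * (- (2 * a\<^sup>2 + c\<^sup>2) / 2 - 2 * k)"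
    using b by (simp add: Ric frame_simps field_simps)
  moreover from leibniz[of "e 1" "e 3" "e 5"]
  have "c * (c\<^sup>2 / 2 - k) = c * (- (a\<^sup>2 + 2 * c\<^sup>2) / 2 - 2 * k)"
    using b by (simp add: Ric frame_simps field_simps)
  ultimately have "a\<^sup>2 / 2 - k = - (2 * a\<^sup>2 + c\<^sup>2) / 2 - 2 * k"
      "c\<^sup>2 / 2 - k = - (a\<^sup>2 + 2 * c\<^sup>2) / 2 - 2 * k"
    using a_pos c_pos by simp_all
  \<comment> \<open>Eliminating \<open>k\<close> leaves \<open>(3 * a\<^sup>2 + c\<^sup>2) / 2 =
    (a\<^sup>2 + 3 * c\<^sup>2) / 2\<close>.\<close>
  then have "a\<^sup>2 = c\<^sup>2" by argo
  then show "b = 0 \<and> a = c" using b a_pos c_pos by simp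
next
  assume *: "b = 0 \<and> a = c"
  \<comment> \<open>The shift solves \<open>a\<^sup>2 = - a\<^sup>2 - k\<close>. The eigenvalues of
    \<open>D\<close> are then in ratio 2 : 3 : 3 : 5 : 5, which the brackets respect since 2 + 3 =
    5.\<close>
  define D where "D = (\<lambda>u. ricci_op br ip u - (- 2 * a\<^sup>2) *\<^sub>R u)"
  have D: "linear D"
    unfolding D_def
    by (intro linear_compose_sub ricci_op_linear[OF A51] linear_scale_self)
  have De: "D (e 1) = a\<^sup>2 *\<^sub>R e 1" "D (e 2) = (3/2 * a\<^sup>2) *\<^sub>R e 2" "D (e 3) = (3/2 * a\<^sup>2) *\<^sub>R e 3"
      "D (e 4) = (5/2 * a\<^sup>2) *\<^sub>R e 4" "D (e 5) = (5/2 * a\<^sup>2) *\<^sub>R e 5"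
    using * by (simp_all add: D_def ricci_op_frame flip: scaleR_diff_left scaleR_minus_left)
  have "derivation br D"
  proof (rule derivation_A51_frameI[OF bilinear_br frame D])
    fix i j :: nat
    assume "i \<in> {1..5}" "j \<in> {1..5}"
    then show "D (br (e i) (e j)) = br (D (e i)) (e j) + br (e i) (D (e j))"
      using * unfolding index
      by (elim insertE emptyE)
        (simp_all add: De br_frame br_frame_0 br_simps alternating linear_0[OF D] linear_cmul[OF D]
          linear_neg[OF D] algebra_simps flip: scaleR_add_left)
  qed
  \<comment> \<open>Taking \<open>l0 = 0\<close> puts the whole shift into the constant, so the
    scalar curvature need not be computed.\<close>
  then have "derivation br
      (\<lambda>u. ricci_op br ip u - (scalar_curvature br ip * 0 + (- 2 * a\<^sup>2)) *\<^sub>R u)"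
    by (simp add: D_def)
  then show "algebraic_schouten_soliton br ip"
    unfolding algebraic_schouten_soliton_def by blast
qed

end

text \<open>Brackets scale by the square of \<open>r\<close> and frame vectors by \<open>r\<close>,
  so one factor \<open>r\<close> passes to the constants.\<close>

lemma A51_frame_scale:
  assumes br: "bilinear br" and v: "A51_frame br v \<alpha> \<beta> \<gamma>" and r: "r \<noteq> 0"
  shows "A51_frame br (\<lambda>i. r *\<^sub>R v i) (r * \<alpha>) (r * \<beta>) (r * \<gamma>)"
proof -
  have img: "(\<lambda>i. r *\<^sub>R v i) ` {1..5} = (*\<^sub>R) r ` v ` {1..5}" by (simp add: image_image)
  have inj: "inj ((*\<^sub>R) r :: 'a \<Rightarrow> 'a)" using r by (simp add: inj_on_def)
  have lin: "linear ((*\<^sub>R) r :: 'a \<Rightarrow> 'a)" by (rule linear_scale_self)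
  have "span ((*\<^sub>R) r ` v ` {1..5}) = (*\<^sub>R) r ` span (v ` {1..5})"
    by (rule linear_span_image[OF lin])
  also have "\<dots> = UNIV"
    using v r by (auto simp: A51_frame_def intro!: surjI[of _ "\<lambda>x. inverse r *\<^sub>R x"])
  finally have "span ((*\<^sub>R) r ` v ` {1..5}) = UNIV" .
  moreover have "independent ((*\<^sub>R) r ` v ` {1..5})"
    using v by (intro linear_independent_injective_image lin inj_on_subset[OF inj])
      (auto simp: A51_frame_def)
  moreover have "inj_on (\<lambda>i. r *\<^sub>R v i) {1..5}"
    using v r by (simp add: A51_frame_def inj_on_def)
  ultimately show ?thesis
    unfolding A51_frame_def img
    using v by (simp add: A51_frame_def bilinear_lmul[OF br] bilinear_rmul[OF br] algebra_simps)
qed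

theorem proposition10:
  fixes br :: "'g::real_vector \<Rightarrow> 'g \<Rightarrow> 'g"
    and ip :: "'g \<Rightarrow> 'g \<Rightarrow> real"
    and v :: "nat \<Rightarrow> 'g"
    and \<eta> \<alpha> \<beta> \<gamma> :: real
  assumes "is_A51 br"
    and "inner_product ip"
    and "\<eta> > 0"
    and "\<forall>i\<in>{1..5}. \<forall>j\<in>{1..5}. \<eta> * ip (v i) (v j) = (if i = j then 1 else 0)"
    and "A51_frame br v \<alpha> \<beta> \<gamma>"
    and "\<alpha> > 0" and "\<gamma> > 0"
  shows "algebraic_schouten_soliton br ip \<longleftrightarrow> \<beta> = 0 \<and> \<alpha> = \<gamma>"
proof -
  interpret metric_lie_algebra br ip by (rule A51_metric_lie_algebra[OF assms(1,2)])
  let ?r = "sqrt \<eta>"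
  interpret orthonormal_A51_frame br ip "\<lambda>i. ?r *\<^sub>R v i" "?r * \<alpha>" "?r * \<beta>" "?r * \<gamma>"
  proof unfold_locales
    show "A51_frame br (\<lambda>i. ?r *\<^sub>R v i) (?r * \<alpha>) (?r * \<beta>) (?r * \<gamma>)"
      using assms(3,5) by (intro A51_frame_scale bilinear_br) auto
    show "ip (?r *\<^sub>R v i) (?r *\<^sub>R v j) = (if i = j then 1 else 0)"
      if "i \<in> {1..5}" "j \<in> {1..5}" for i j
      using assms(3,4) that by (simp add: ip_simps flip: mult.assoc)
  qed (use assms in auto)
  \<comment> \<open>The condition is homogeneous in the constants, so the factor
    \<open>sqrt \<eta>\<close> cancels.\<close>
  show ?thesis using schouten_soliton_iff assms(3) by simp
qed

end
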